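(* Let $a,b\in\mathbb{N}_0$ with $a+b\neq 0$ and let $\mathbf{c}=(c_1,c_2,\dots)$ be a sequence with $c_j\in\mathbb{N}_0$ for all $j\ge 1$. Let $(y_n)_{n\ge 0}$ be the sequence defined by $y_0=1$ and $y_n=\left|\mathfrak{D}^{\mathbf{c}}_n(a,b)\right|$ for $n\ge 1$, where $\mathfrak{D}^{\mathbf{c}}_n(a,b)$ is the set of colored Dyck words of semilength $(a+b)n$ defined in the context. Then for every $n\ge 1$, $$y_n=\sum_{\ell=1}^n c_\ell \sum_{i_1+\cdots+i_{a\ell+b}=n-\ell} y_{i_1}\cdots y_{i_{a\ell+b}},$$ where the inner sum runs over all $(a\ell+b)$-tuples $(i_1,\dots,i_{a\ell+b})$ of nonnegative integers with sum $n-\ell$.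
   Context: $\mathbb{N}_0=\{0,1,2,\dots\}$. A Dyck word of semilength $m$ is a word in the letters $u$ and $d$ with exactly $m$ letters $u$ and $m$ letters $d$, such that every prefix contains at least as many $u$'s as $d$'s (it encodes a lattice path from $(0,0)$ to $(2m,0)$ staying in the first quadrant, with up-steps $u=(1,1)$ and down-steps $d=(1,-1)$). For $a,b\in\mathbb{N}_0$ with $a+b\ne 0$, $\mathbf{c}=(c_1,c_2,\dots)$ with $c_j\in\mathbb{N}_0$, and $n\ge 1$, the set $\mathfrak{D}^{\mathbf{c}}_n(a,b)$ consists of the Dyck words of semilength $(a+b)n$ that are concatenations of strings of the form $P_0=d$ and $P_j=u^{(a+b)j}d^{\,b(j-1)+1}$ for $j=1,\dots,n$ (each usable any number of times, in any order), such that each maximal $(a+b)j$-ascent substring $u^{(a+b)j}$ (maximal run of consecutive $u$'s, of length $(a+b)j$) is colored in one of $c_j$ different ways; $c_j=0$ means that maximal ascents of length $(a+b)j$ are not allowed. Elements of $\mathfrak{D}^{\mathbf{c}}_n(a,b)$ are words together with a choice of color for each maximal ascent; two elements are equal only if both the words and the colors agree. (Since each $P_j$ with $j\ge1$ ends in at least one $d$, the maximal ascents of such a word are exactly the blocks $u^{(a+b)j}$ of the strings $P_j$, $j\ge 1$, that occur.) *)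

theory Defs
  imports "HOL-Library.FuncSet"
begin

datatype step = Up | Down

definition dyck_word :: "nat \<Rightarrow> step list \<Rightarrow> bool" where
  "dyck_word m w \<longleftrightarrow>
     count_list w Up = m \<and> count_list w Down = m \<and>
     (\<forall>k\<le>length w. count_list (take k w) Down \<le> count_list (take k w) Up)"

definition block :: "nat \<Rightarrow> nat \<Rightarrow> nat \<Rightarrow> step list" where
  "block a b j =
     (if j = 0 then [Down]
      else replicate ((a + b) * j) Up @ replicate (b * (j - 1) + 1) Down)"

(* A maximal ascent is represented by the pair (i, k) of its starting position and its length. *)
definition max_ascents :: "step list \<Rightarrow> (nat \<times> nat) set" where
  "max_ascents w =
     {(i, k). 1 \<le> k \<and> i + k \<le> length w \<and> (\<forall>t<k. w ! (i + t) = Up) \<and>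
        (i = 0 \<or> w ! (i - 1) = Down) \<and>
        (i + k = length w \<or> w ! (i + k) = Down)}"

definition block_dyck_words :: "nat \<Rightarrow> nat \<Rightarrow> nat \<Rightarrow> step list set" where
  "block_dyck_words a b n =
     {w. dyck_word ((a + b) * n) w \<and>
         (\<exists>js. set js \<subseteq> {0..n} \<and> w = concat (map (block a b) js))}"

(* The colors available for an ascent of length (a + b) * j are 0, ..., c j - 1.  In a word of
   block_dyck_words every maximal ascent has such a length, so the division is exact.
   The value c 0 is never used.  A coloring is undefined outside the maximal ascents, so that
   equality of colorings is equality of the colors of all maximal ascents. *)
definition colorings ::
    "nat \<Rightarrow> nat \<Rightarrow> (nat \<Rightarrow> nat) \<Rightarrow> step list \<Rightarrow> (nat \<times> nat \<Rightarrow> nat) set" where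
  "colorings a b c w = (\<Pi>\<^sub>E (i, k) \<in> max_ascents w. {..<c (k div (a + b))})"

definition colored_dyck_words ::
    "nat \<Rightarrow> nat \<Rightarrow> (nat \<Rightarrow> nat) \<Rightarrow> nat \<Rightarrow> (step list \<times> (nat \<times> nat \<Rightarrow> nat)) set" where
  "colored_dyck_words a b c n = (SIGMA w : block_dyck_words a b n. colorings a b c w)"

lemma finite_colored_dyck_words: "finite (colored_dyck_words a b c n)"
proof -
  have len: "length w = count_list w Up + count_list w Down" for w :: "step list"
  proof (induction w)
    case (Cons x xs)
    then show ?case by (cases x) auto
  qed simp
  have univ: "(UNIV :: step set) = {Up, Down}"
    using step.exhaust by auto
  have "block_dyck_words a b n \<subseteq> {w. set w \<subseteq> {Up, Down} \<and> length w = 2 * ((a + b) * n)}"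
    using univ by (auto simp: block_dyck_words_def dyck_word_def len)
  then have words: "finite (block_dyck_words a b n)"
    by (rule finite_subset) (simp add: finite_lists_length_eq)
  have "max_ascents w \<subseteq> {..length w} \<times> {..length w}" for w
    by (auto simp: max_ascents_def)
  then have "finite (max_ascents w)" for w
    by (rule finite_subset) simp
  then have "finite (colorings a b c w)" for w
    unfolding colorings_def by (intro finite_PiE) auto
  with words show ?thesis
    unfolding colored_dyck_words_def by (intro finite_SigmaI) auto
qed

end

theory Submission
  imports Defs "HOL-Computational_Algebra.Formal_Power_Series"
begin

text \<open>
  A word of blocks is read as the list of its block indices. The block \<^term>\<open>block a b j\<close> changes
  the height by \<^term>\<open>-1\<close> if \<^term>\<open>j = 0\<close> and by \<^term>\<open>a * j + b - 1\<close> otherwise, and the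
  Dyck condition only has to be tested at the ends of blocks. Let \<open>W h n\<close> be the weighted number of
  such index lists of sum \<open>n\<close> that lead from height \<open>h\<close> to \<open>0\<close>. Splitting off the first block gives
  a recurrence for \<open>W\<close>, and the coefficient of \<open>x ^ n\<close> in \<open>Y ^ (h + 1)\<close>, where \<open>Y\<close> is the
  generating function of \<open>W 0\<close>, satisfies the same recurrence. Hence the two agree, and the
  recurrence for \<open>W 0 n\<close> is the claim.
\<close>

unbundle fps_syntax

section \<open>Dyck words as height walks and as lists of block indices\<close>

fun returns_to_zero :: "nat \<Rightarrow> step list \<Rightarrow> bool" where
  "returns_to_zero h [] \<longleftrightarrow> h = 0"
| "returns_to_zero h (Up # w) \<longleftrightarrow> returns_to_zero (Suc h) w"
| "returns_to_zero h (Down # w) \<longleftrightarrow> 0 < h \<and> returns_to_zero (h - 1) w"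

lemma all_le_Suc_iff: "(\<forall>k\<le>Suc m. P k) \<longleftrightarrow> P 0 \<and> (\<forall>k\<le>m. P (Suc k))"
  by (metis Suc_le_mono le0 not0_implies_Suc)

text \<open>An arbitrary starting height \<open>h\<close> makes the prefix condition inductive:
  reading a letter only shifts \<open>h\<close>, and a \<open>Down\<close> at height 0 already fails
  at the prefix of length 1.\<close>

lemma returns_to_zero_iff:
  "returns_to_zero h w \<longleftrightarrow> count_list w Down = h + count_list w Up \<and>
     (\<forall>k\<le>length w. count_list (take k w) Down \<le> h + count_list (take k w) Up)"
proof (induction h w rule: returns_to_zero.induct)
  case (3 h w)
  then show ?case by (cases h) (auto simp: all_le_Suc_iff)
qed (auto simp: all_le_Suc_iff)

lemma dyck_word_iff: "dyck_word m w \<longleftrightarrow> returns_to_zero 0 w \<and> count_list w Up = m"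
  by (auto simp: dyck_word_def returns_to_zero_iff)

lemma returns_to_zero_replicate_Up:
  "returns_to_zero h (replicate p Up @ w) \<longleftrightarrow> returns_to_zero (h + p) w"
  by (induction p arbitrary: h) auto

lemma returns_to_zero_replicate_Down:
  "returns_to_zero h (replicate q Down @ w) \<longleftrightarrow> q \<le> h \<and> returns_to_zero (h - q) w"
proof (induction q arbitrary: h)
  case (Suc q)
  then show ?case by (cases h) simp_all
qed simp

text \<open>Only index 0 can lower the height, hence the single height test there. For
  \<open>j > 0\<close> and \<open>a + b \<noteq> 0\<close> a block climbs first and ends
  \<open>a * j + b - 1 \<ge> 0\<close> above its start, so the subtraction is exact.\<close>

fun block_path :: "nat \<Rightarrow> nat \<Rightarrow> nat \<Rightarrow> nat list \<Rightarrow> bool" where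
  "block_path a b h [] \<longleftrightarrow> h = 0"
| "block_path a b h (j # js) \<longleftrightarrow>
     (if j = 0 then 0 < h \<and> block_path a b (h - 1) js else block_path a b (h + a * j + b - 1) js)"

lemma returns_to_zero_blocks:
  assumes "a + b \<noteq> 0"
  shows "returns_to_zero h (concat (map (block a b) js)) \<longleftrightarrow> block_path a b h js"
proof (induction js arbitrary: h)
  case (Cons j js)
  show ?case
  proof (cases j)
    case (Suc i)
    have "b * i + 1 \<le> h + (a + b) * j" "h + (a + b) * j - (b * i + 1) = h + a * j + b - 1"
      using assms by (auto simp: Suc algebra_simps)
    then show ?thesis
      using Cons.IH Suc
      by (simp add: block_def returns_to_zero_replicate_Up returns_to_zero_replicate_Down
            del: replicate.simps)
  qed (use Cons.IH in \<open>auto simp: block_def\<close>)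
qed simp

lemma count_list_replicate: "count_list (replicate n x) y = (if x = y then n else 0)"
  by (induction n) auto

lemma count_Up_blocks: "count_list (concat (map (block a b) js)) Up = (a + b) * sum_list js"
  by (induction js) (auto simp: block_def count_list_replicate algebra_simps)

text \<open>Unique decoding: every block contains a \<open>Down\<close>, so the initial run of
  \<open>Up\<close> lies in the first block, and its length \<open>(a + b) * j\<close> determines
  \<open>j\<close>.\<close>

lemma blocks_inj:
  assumes "a + b \<noteq> 0"
  shows "inj (\<lambda>js. concat (map (block a b) js))"
proof -
  have tw: "takeWhile (\<lambda>x. x = Up) (block a b j @ w) = replicate ((a + b) * j) Up" for j w
    by (auto simp: block_def takeWhile_append)
  have ne: "block a b j \<noteq> []" for j
    by (simp add: block_def)
  have "js = js'" if "concat (map (block a b) js) = concat (map (block a b) js')" for js js'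
    using that
  proof (induction js arbitrary: js')
    case Nil
    then show ?case using ne by (cases js') auto
  next
    case (Cons j js)
    then obtain i ks where js': "js' = i # ks"
      using ne by (cases js') auto
    then have eq: "block a b j @ concat (map (block a b) js) = block a b i @ concat (map (block a b) ks)"
      using Cons.prems by simp
    have "replicate ((a + b) * j) Up = replicate ((a + b) * i) Up"
      using arg_cong[OF eq, of "takeWhile (\<lambda>x. x = Up)"] unfolding tw .
    then have "j = i"
      using assms by (auto simp: replicate_eq_replicate)
    then show ?case
      using eq Cons.IH js' by simp
  qed
  then show ?thesis by (rule injI)
qed

section \<open>Index lists of given sum: finiteness and the first-block recurrence\<close>

definition block_paths :: "nat \<Rightarrow> nat \<Rightarrow> nat \<Rightarrow> nat \<Rightarrow> nat list set" where
  "block_paths a b h n = {js. block_path a b h js \<and> sum_list js = n}"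

lemma block_dyck_words_eq:
  assumes "a + b \<noteq> 0"
  shows "block_dyck_words a b n = (\<lambda>js. concat (map (block a b) js)) ` block_paths a b 0 n"
proof -
  have "dyck_word ((a + b) * n) (concat (map (block a b) js)) \<longleftrightarrow> js \<in> block_paths a b 0 n" for js
    using assms
    by (auto simp: dyck_word_iff returns_to_zero_blocks count_Up_blocks block_paths_def)
  \<comment> \<open>The index bound in \<open>block_dyck_words\<close> follows from the sum: no
    entry exceeds \<open>n\<close>.\<close>
  moreover have "set js \<subseteq> {0..n}" if "js \<in> block_paths a b 0 n" for js
    using that member_le_sum_list by (fastforce simp: block_paths_def)
  ultimately show ?thesis
    by (auto simp: block_dyck_words_def)
qed

text \<open>Zero entries leave the sum unchanged, so finiteness requires a bound on the length. The
  height plus \<open>a + b\<close> times the remaining sum drops with each block: by 1 for index 0,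
  by \<open>b * (j - 1) + 1\<close> otherwise.\<close>

lemma length_block_path:
  assumes "a + b \<noteq> 0" "block_path a b h js"
  shows "length js \<le> h + (a + b) * sum_list js"
  using assms(2)
proof (induction js arbitrary: h)
  case (Cons j js)
  show ?case
  proof (cases j)
    case 0
    then show ?thesis using Cons.IH[of "h - 1"] Cons.prems by auto
  next
    case (Suc i)
    then have "length js \<le> h + a * j + b - 1 + (a + b) * sum_list js"
      using Cons.IH Cons.prems by simp
    moreover have "0 < a * j + b"
      using assms(1) Suc by auto
    ultimately have "length (j # js) \<le> h + a * j + b + (a + b) * sum_list js"
      by (simp only: length_Cons)
    then show ?thesis
      using Suc by (simp add: algebra_simps)
  qed
qed simp

lemma finite_block_paths:
  assumes "a + b \<noteq> 0"
  shows "finite (block_paths a b h n)"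
proof (rule finite_subset)
  show "block_paths a b h n \<subseteq> {js. set js \<subseteq> {0..n} \<and> length js \<le> h + (a + b) * n}"
    using length_block_path[OF assms] member_le_sum_list by (fastforce simp: block_paths_def)
qed (simp add: finite_lists_length_le)

lemma Cons_in_UN_iff: "x # xs \<in> (\<Union>i\<in>I. (#) i ` A i) \<longleftrightarrow> x \<in> I \<and> xs \<in> A x"
  by auto

lemma block_paths_unfold:
  "block_paths a b h n =
     (if h = 0 \<and> n = 0 then {[]} else {}) \<union>
     (if h = 0 then {} else (#) 0 ` block_paths a b (h - 1) n) \<union>
     (\<Union>l\<in>{1..n}. (#) l ` block_paths a b (h + a * l + b - 1) (n - l))" (is "_ = ?R")
proof (rule set_eqI)
  fix js
  show "js \<in> block_paths a b h n \<longleftrightarrow> js \<in> ?R"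
  proof (cases js)
    case (Cons j ks)
    then show ?thesis
      unfolding Un_iff Cons Cons_in_UN_iff by (cases j) (auto simp: block_paths_def)
  qed (auto simp: block_paths_def)
qed

text \<open>The number of colorings of the encoded word; index 0 gives the factor 1 because its
  block has no ascent.\<close>

definition path_weight :: "(nat \<Rightarrow> nat) \<Rightarrow> nat list \<Rightarrow> nat" where
  "path_weight c js = (\<Prod>j\<leftarrow>js. if j = 0 then 1 else c j)"

definition path_sum :: "nat \<Rightarrow> nat \<Rightarrow> (nat \<Rightarrow> nat) \<Rightarrow> nat \<Rightarrow> nat \<Rightarrow> nat" where
  "path_sum a b c h n = (\<Sum>js\<in>block_paths a b h n. path_weight c js)"

lemma path_sum_rec:
  assumes "a + b \<noteq> 0"
  shows "path_sum a b c h n =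
     (if h = 0 \<and> n = 0 then 1 else 0) + (if h = 0 then 0 else path_sum a b c (h - 1) n) +
     (\<Sum>l = 1..n. c l * path_sum a b c (h + a * l + b - 1) (n - l))"
proof -
  let ?P = "block_paths a b" and ?w = "path_weight c"
  let ?A = "if h = 0 \<and> n = 0 then {[]} else {}"
  let ?B = "if h = 0 then {} else (#) 0 ` ?P (h - 1) n"
  let ?C = "\<lambda>l. (#) l ` ?P (h + a * l + b - 1) (n - l)"
  note fin = finite_block_paths[OF assms]
  have img: "sum ?w ((#) l ` ?P h' n') = (if l = 0 then 1 else c l) * path_sum a b c h' n'" for l h' n'
    by (subst sum.reindex) (auto simp: path_sum_def path_weight_def sum_distrib_left inj_on_def)
  have "path_sum a b c h n = sum ?w (?A \<union> ?B \<union> (\<Union>l\<in>{1..n}. ?C l))"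
    unfolding path_sum_def by (subst block_paths_unfold) (rule refl)
  also have "\<dots> = sum ?w (?A \<union> ?B) + sum ?w (\<Union>l\<in>{1..n}. ?C l)"
    by (rule sum.union_disjoint) (auto simp: fin)
  also have "sum ?w (?A \<union> ?B) = sum ?w ?A + sum ?w ?B"
    by (rule sum.union_disjoint) (auto simp: fin)
  also have "sum ?w (\<Union>l\<in>{1..n}. ?C l) = (\<Sum>l = 1..n. sum ?w (?C l))"
    by (rule sum.UNION_disjoint) (auto simp: fin)
  also have "\<dots> = (\<Sum>l = 1..n. c l * path_sum a b c (h + a * l + b - 1) (n - l))"
    by (rule sum.cong) (auto simp: img)
  also have "sum ?w ?A = (if h = 0 \<and> n = 0 then 1 else 0)"
    by (simp add: path_weight_def)
  also have "sum ?w ?B = (if h = 0 then 0 else path_sum a b c (h - 1) n)"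
    by (simp add: img)
  finally show ?thesis .
qed

section \<open>Maximal ascents and the number of colorings\<close>

definition ascent_weight :: "(nat \<Rightarrow> nat) \<Rightarrow> step list \<Rightarrow> nat" where
  "ascent_weight f w = (\<Prod>(i, k)\<in>max_ascents w. f k)"

text \<open>A \<open>Down\<close> belongs to no ascent and bounds ascents on both sides, so none
  crosses it. This makes \<open>ascent_weight\<close> multiplicative.\<close>

lemma max_ascents_append_Down:
  "max_ascents (v @ Down # w) =
     max_ascents v \<union> (\<lambda>(i, k). (i + Suc (length v), k)) ` max_ascents w" (is "?L = ?R")
proof -
  let ?p = "length v" and ?u = "v @ Down # w"
  have left: "(i, k) \<in> ?L \<longleftrightarrow> (i, k) \<in> max_ascents v" if "i + k \<le> ?p" for i k
    using that by (auto simp: max_ascents_def nth_append)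
  have right: "(i + Suc ?p, k) \<in> ?L \<longleftrightarrow> (i, k) \<in> max_ascents w" for i k
  proof -
    have "?u ! (i + Suc ?p + t) = w ! (i + t)" for t
      by (simp add: nth_append)
    \<comment> \<open>For \<open>i = 0\<close> the preceding letter is the separating
      \<open>Down\<close>, which matches the start-of-word clause for \<open>w\<close>.\<close>
    moreover have "?u ! (i + Suc ?p - 1) = (if i = 0 then Down else w ! (i - 1))"
      by (cases i) (auto simp: nth_append)
    ultimately show ?thesis
      by (simp add: max_ascents_def)
  qed
  have mid: "i + k \<le> ?p \<or> ?p < i" if "(i, k) \<in> ?L" for i k
  proof (rule ccontr)
    assume "\<not> (i + k \<le> ?p \<or> ?p < i)"
    then have "i \<le> ?p" "?p - i < k"
      by auto
    then have "?u ! (i + (?p - i)) = Up"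
      using that unfolding max_ascents_def by blast
    with \<open>i \<le> ?p\<close> have "?u ! ?p = Up" by simp
    then show False by (simp add: nth_append)
  qed
  have v_bound: "i + k \<le> ?p" if "(i, k) \<in> max_ascents v" for i k
    using that by (simp add: max_ascents_def)
  have "(i, k) \<in> ?R" if "(i, k) \<in> ?L" for i k
    using mid[OF that]
  proof
    assume "?p < i"
    then have "i = (i - Suc ?p) + Suc ?p" by simp
    then show ?thesis using that right by (metis (mono_tags, lifting) UnI2 case_prod_conv image_eqI)
  qed (use left that in auto)
  moreover have "(i, k) \<in> ?L" if "(i, k) \<in> ?R" for i k
    using that left v_bound right by fastforce
  ultimately show ?thesis by (intro set_eqI) (metis surj_pair)
qed

lemma finite_max_ascents: "finite (max_ascents w)"
  by (rule finite_subset[of _ "{..length w} \<times> {..length w}"]) (auto simp: max_ascents_def)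

lemma ascent_weight_append_Down:
  "ascent_weight f (v @ Down # w) = ascent_weight f v * ascent_weight f w"
proof -
  let ?s = "\<lambda>(i, k). (i + Suc (length v), k) :: nat \<times> nat"
  have "ascent_weight f (v @ Down # w) =
      ascent_weight f v * (\<Prod>(i, k)\<in>?s ` max_ascents w. f k)"
    unfolding ascent_weight_def max_ascents_append_Down
    by (rule prod.union_disjoint) (auto simp: finite_max_ascents, auto simp: max_ascents_def)
  also have "(\<Prod>(i, k)\<in>?s ` max_ascents w. f k) = ascent_weight f w"
    unfolding ascent_weight_def
    by (subst prod.reindex) (auto simp: inj_on_def intro!: prod.cong)
  finally show ?thesis .
qed

lemma ascent_weight_Nil: "ascent_weight f [] = 1"
proof -
  have "max_ascents [] = {}"
    by (auto simp: max_ascents_def)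
  then show ?thesis
    by (simp add: ascent_weight_def)
qed

lemma ascent_weight_replicate_Down: "ascent_weight f (replicate q Down @ w) = ascent_weight f w"
proof (induction q)
  case (Suc q)
  then show ?case
    using ascent_weight_append_Down[of f "[]"] by (simp add: ascent_weight_Nil)
qed simp

lemma ascent_weight_replicate_Up:
  assumes "0 < p"
  shows "ascent_weight f (replicate p Up) = f p"
proof -
  have "max_ascents (replicate p Up) = {(0, p)}"
    using assms by (auto simp: max_ascents_def) (metis le_neq_implies_less nth_replicate step.distinct(1))
  then show ?thesis
    by (simp add: ascent_weight_def)
qed

text \<open>Each block of index \<open>j > 0\<close> has exactly one maximal ascent, of length
  \<open>(a + b) * j\<close>, and the division recovers \<open>j\<close>.\<close>

lemma ascent_weight_blocks:
  assumes "a + b \<noteq> 0"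
  shows "ascent_weight (\<lambda>k. c (k div (a + b))) (concat (map (block a b) js)) = path_weight c js"
proof (induction js)
  case Nil
  then show ?case by (simp add: ascent_weight_Nil path_weight_def)
next
  case (Cons j js)
  let ?f = "\<lambda>k. c (k div (a + b))" and ?w = "concat (map (block a b) js)"
  show ?case
  proof (cases j)
    case 0
    then show ?thesis
      using Cons.IH ascent_weight_append_Down[of ?f "[]" ?w]
      by (simp add: block_def[of a b 0] ascent_weight_Nil path_weight_def)
  next
    case (Suc i)
    \<comment> \<open>The first \<open>Down\<close> of the block serves as separator; the other
      \<open>b * i\<close> leave the weight unchanged.\<close>
    have "block a b j @ ?w = replicate ((a + b) * j) Up @ Down # (replicate (b * i) Down @ ?w)"
      by (simp add: block_def Suc)
    then have "ascent_weight ?f (block a b j @ ?w) = ?f ((a + b) * j) * ascent_weight ?f ?w"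
      using assms Suc
      by (simp only: ascent_weight_append_Down ascent_weight_replicate_Down)
        (simp add: ascent_weight_replicate_Up del: replicate.simps)
    moreover have "(a + b) * j div (a + b) = j"
      using assms by (rule nonzero_mult_div_cancel_left)
    ultimately show ?thesis
      using Cons.IH Suc by (simp add: path_weight_def)
  qed
qed

lemma card_colorings: "card (colorings a b c w) = ascent_weight (\<lambda>k. c (k div (a + b))) w"
  by (simp add: colorings_def ascent_weight_def card_PiE finite_max_ascents case_prod_unfold)

text \<open>Colorings are counted word by word, and unique decoding turns the sum over words into
  one over index lists.\<close>

lemma card_colored_dyck_words:
  assumes "a + b \<noteq> 0"
  shows "card (colored_dyck_words a b c n) = path_sum a b c 0 n"
proof -
  have fin: "finite (colorings a b c w)" for w
    unfolding colorings_def by (rule finite_PiE) (auto simp: finite_max_ascents)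
  have "card (colored_dyck_words a b c n) = (\<Sum>w\<in>block_dyck_words a b n. card (colorings a b c w))"
    unfolding colored_dyck_words_def
    by (rule card_SigmaI) (auto simp: fin block_dyck_words_eq[OF assms] finite_block_paths[OF assms])
  also have "\<dots> = path_sum a b c 0 n"
    unfolding block_dyck_words_eq[OF assms] path_sum_def
    by (subst sum.reindex)
      (auto intro: inj_on_subset[OF blocks_inj[OF assms]] simp: card_colorings ascent_weight_blocks[OF assms])
  finally show ?thesis .
qed

section \<open>Powers of generating functions\<close>

lemma fps_power_nth_semiring:
  fixes F :: "'a::comm_semiring_1 fps"
  shows "(F ^ k) $ n = (\<Sum>is\<in>natpermute n k. prod_list (map (fps_nth F) is))"
proof (induction k arbitrary: n)
  case 0
  then show ?case by (simp add: natpermute_0)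
next
  case (Suc k)
  let ?w = "\<lambda>is. prod_list (map (fps_nth F) is)"
  \<comment> \<open>Splitting off the first entry turns the sum over lists into the convolution for
    \<open>F * F ^ k\<close>.\<close>
  have "natpermute n (Suc k) = (\<Union>i\<in>{0..n}. (#) i ` natpermute (n - i) k)"
  proof (rule set_eqI)
    fix xs
    show "xs \<in> natpermute n (Suc k) \<longleftrightarrow> xs \<in> (\<Union>i\<in>{0..n}. (#) i ` natpermute (n - i) k)"
    proof (cases xs)
      case (Cons x ys)
      then show ?thesis
        unfolding Cons Cons_in_UN_iff by (auto simp: natpermute_def)
    qed (auto simp: natpermute_def)
  qed
  then have "(\<Sum>is\<in>natpermute n (Suc k). ?w is) = sum ?w (\<Union>i\<in>{0..n}. (#) i ` natpermute (n - i) k)"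
    by simp
  also have "\<dots> = (\<Sum>i = 0..n. sum ?w ((#) i ` natpermute (n - i) k))"
    by (rule sum.UNION_disjoint) (auto simp: natpermute_finite)
  also have "\<dots> = (\<Sum>i = 0..n. F $ i * (F ^ k) $ (n - i))"
    by (simp add: Suc.IH sum.reindex sum_distrib_left)
  finally show ?case
    by (simp add: fps_mult_nth)
qed

text \<open>The exponent has a combinatorial meaning: the first descents to \<open>h - 1\<close>,
  ..., 0 cut a path from height \<open>h\<close> into \<open>h + 1\<close> pieces, each returning to
  its starting level. The proof compares recurrences, by strong induction on \<open>n\<close> and,
  for fixed \<open>n\<close>, induction on \<open>h\<close>, since an initial index 0 lowers
  \<open>h\<close> but keeps \<open>n\<close>.\<close>

lemma path_sum_eq_power:
  assumes "a + b \<noteq> 0"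
  shows "path_sum a b c h n = (Abs_fps (path_sum a b c 0) ^ Suc h) $ n"
proof (induction n arbitrary: h rule: less_induct)
  case (less n)
  let ?W = "path_sum a b c" and ?Y = "Abs_fps (path_sum a b c 0)"
  note rec = path_sum_rec[OF assms]
  \<comment> \<open>Positivity of \<open>a * l + b\<close> makes height \<open>a * l + b - 1\<close>
    correspond to exponent \<open>a * l + b\<close> without truncation.\<close>
  have pos: "Suc (a * l + b - 1) = a * l + b" if "1 \<le> l" for l
    using assms that by (cases l) auto
  \<comment> \<open>At height 0 with \<open>i > 0\<close> the first index must be some
    \<open>l > 0\<close>, and \<open>i - l < n\<close> brings the outer hypothesis into
    play.\<close>
  have Y: "?W 0 i = (\<Sum>l = 1..i. c l * (?Y ^ (a * l + b)) $ (i - l))" if "i \<in> {1..n}" for i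
  proof -
    have "?W 0 i = (\<Sum>l = 1..i. c l * ?W (a * l + b - 1) (i - l))"
      using that by (subst rec) simp
    also have "\<dots> = (\<Sum>l = 1..i. c l * (?Y ^ (a * l + b)) $ (i - l))"
    proof (rule sum.cong)
      fix l assume "l \<in> {1..i}"
      then have "i - l < n" "1 \<le> l" using that by auto
      then show "c l * ?W (a * l + b - 1) (i - l) = c l * (?Y ^ (a * l + b)) $ (i - l)"
        using less.IH[of "i - l" "a * l + b - 1"] pos by (simp only:)
    qed simp
    finally show ?thesis .
  qed
  show ?case
  proof (induction h)
    case 0
    show ?case by simp
  next
    case (Suc h)
    let ?V = "\<lambda>k m. (?Y ^ k) $ m"
    \<comment> \<open>One factor \<open>?Y\<close> is split off: its constant term will account for
      an initial index 0, its other coefficients for an initial index \<open>l > 0\<close>.\<close>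
    have "?V (Suc (Suc h)) n = (\<Sum>i = 0..n. ?W 0 i * ?V (Suc h) (n - i))"
      by (subst power_Suc) (simp only: fps_mult_nth fps_nth_Abs_fps)
    also have "\<dots> = ?W 0 0 * ?V (Suc h) n + (\<Sum>i = 1..n. ?W 0 i * ?V (Suc h) (n - i))"
      by (simp add: sum.atLeast_Suc_atMost)
    also have "?W 0 0 = 1"
      by (subst rec) simp
    also have "(\<Sum>i = 1..n. ?W 0 i * ?V (Suc h) (n - i)) =
        (\<Sum>i = 1..n. \<Sum>l = 1..i. c l * (?V (a * l + b) (i - l) * ?V (Suc h) (n - i)))"
      by (rule sum.cong) (simp_all only: Y sum_distrib_right mult.assoc)
    \<comment> \<open>Interchange of summation over the triangle
      \<open>1 \<le> l \<le> i \<le> n\<close>.\<close>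
    also have "\<dots> = (\<Sum>l = 1..n. \<Sum>i = l..n. c l * (?V (a * l + b) (i - l) * ?V (Suc h) (n - i)))"
      by (simp only: sum.Sigma finite_atLeastAtMost ball_UNIV ball_triv simp_thms)
        (rule sum.reindex_bij_witness[of _ prod.swap prod.swap], auto)
    also have "\<dots> = (\<Sum>l = 1..n. c l * ?V (a * l + b + Suc h) (n - l))"
    proof (rule sum.cong)
      fix l assume "l \<in> {1..n}"
      \<comment> \<open>Shifting \<open>i\<close> by \<open>l\<close> exposes the Cauchy product of
        the two powers.\<close>
      then have "(\<Sum>i = l..n. ?V (a * l + b) (i - l) * ?V (Suc h) (n - i)) =
          (\<Sum>i = 0..n - l. ?V (a * l + b) i * ?V (Suc h) (n - l - i))"
        by (intro sum.reindex_bij_witness[of _ "\<lambda>i. i + l" "\<lambda>i. i - l"]) auto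
      then show "(\<Sum>i = l..n. c l * (?V (a * l + b) (i - l) * ?V (Suc h) (n - i))) =
          c l * ?V (a * l + b + Suc h) (n - l)"
        by (simp only: power_add fps_mult_nth flip: sum_distrib_left)
    qed simp
    \<comment> \<open>The exponent is one more than the height reached from \<open>Suc h\<close> by
      block \<open>l\<close>, so the outer hypothesis converts back to path sums.\<close>
    also have "\<dots> = (\<Sum>l = 1..n. c l * ?W (Suc h + a * l + b - 1) (n - l))"
    proof (rule sum.cong)
      fix l assume "l \<in> {1..n}"
      then have "a * l + b + Suc h = Suc (Suc h + a * l + b - 1)" "n - l < n"
        by auto
      then show "c l * ?V (a * l + b + Suc h) (n - l) = c l * ?W (Suc h + a * l + b - 1) (n - l)"
        using less.IH[of "n - l" "Suc h + a * l + b - 1"] by (simp only:)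
    qed simp
    \<comment> \<open>The remaining term \<open>?V (Suc h) n\<close> is \<open>?W h n\<close> by the
      inner hypothesis, which completes the first-block recurrence at height
      \<open>Suc h\<close>.\<close>
    finally show ?case
      using Suc.IH rec[of c "Suc h" n] by simp
  qed
qed

theorem theorem2p1:
  fixes a b :: nat and c y :: "nat \<Rightarrow> nat"
  assumes "a + b \<noteq> 0"
    and "y 0 = 1"
    and "\<And>m. 1 \<le> m \<Longrightarrow> y m = card (colored_dyck_words a b c m)"
    and "1 \<le> n"
  shows "y n = (\<Sum>l = 1..n. c l *
           (\<Sum>is \<in> {is :: nat list. length is = a * l + b \<and> sum_list is = n - l}.
              prod_list (map y is)))"
proof -
  note rec = path_sum_rec[OF assms(1)]
  have "path_sum a b c 0 0 = 1"
    by (subst rec) simp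
  \<comment> \<open>The prescribed value \<open>y 0 = 1\<close> agrees with the empty list, the only
    index list of sum 0 from height 0.\<close>
  have y: "y = path_sum a b c 0"
  proof
    fix m
    show "y m = path_sum a b c 0 m"
      using assms(2,3) \<open>path_sum a b c 0 0 = 1\<close>
      by (cases "m = 0") (auto simp: card_colored_dyck_words[OF assms(1)])
  qed
  have "y n = (\<Sum>l = 1..n. c l * path_sum a b c (a * l + b - 1) (n - l))"
    unfolding y using assms(4) by (subst rec) simp
  also have "\<dots> = (\<Sum>l = 1..n. c l *
           (\<Sum>is \<in> {is :: nat list. length is = a * l + b \<and> sum_list is = n - l}.
              prod_list (map y is)))"
  proof (rule sum.cong)
    fix l assume "l \<in> {1..n}"
    then have pos: "Suc (a * l + b - 1) = a * l + b"
      using assms(1) by (cases l) auto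
    have "path_sum a b c (a * l + b - 1) (n - l) = (Abs_fps y ^ (a * l + b)) $ (n - l)"
      using path_sum_eq_power[OF assms(1), of c "a * l + b - 1" "n - l"] by (simp only: pos y)
    also have "\<dots> = (\<Sum>is\<in>natpermute (n - l) (a * l + b). prod_list (map y is))"
      unfolding fps_power_nth_semiring by (simp add: Abs_fps_inverse)
    finally show "c l * path_sum a b c (a * l + b - 1) (n - l) = c l *
           (\<Sum>is \<in> {is :: nat list. length is = a * l + b \<and> sum_list is = n - l}.
              prod_list (map y is))"
      by (simp add: natpermute_def)
  qed simp
  finally show ?thesis .
qed

end
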